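(* Let $m\in\mathbb{N}$, let $\eta$ be a finite binomid index of length $m$, and let $\tilde\eta$ be its lex-minimal extension, with partial sums $(S_i)_{i\ge1}$ and averages $A_i=S_i/i$. Let $A_{\max}=\max\{A_i\mid 1\le i\le m\}$. Then the minimal period of $\tilde\eta$ is \[\gcd\big(\{i\in\mathbb{N}\mid i\le m,\ A_i=A_{\max}\}\big).\]
   Context: $\mathbb{N}=\{1,2,3,\dots\}$. A sequence $(e_i)_{i\le m}$ of nonnegative integers, where $m\in\mathbb{N}$ (finite sequence of length $m$) or $m=\infty$ (infinite sequence indexed by $\mathbb{N}$), is a binomid index if $\sum_{i=n-k+1}^{n}e_i\ge\sum_{i=1}^k e_i$ for all $k,n\in\mathbb{N}$ with $1\le k\le n\le m$. Every finite binomid index $\eta$ extends to an infinite binomid index having $\eta$ as its initial segment; among all such extensions there is a unique lexicographically minimal one, denoted $\tilde\eta$ and called the lex-minimal extension of $\eta$. The partial sums of $(e_i)_{i\ge1}$ are $S_i=e_1+\dots+e_i$. It is known that $\tilde\eta$ is eventually periodic, i.e. $\tilde\eta=\eta_0(\eta_1)^\infty$ for some finite sequences $\eta_0$ (possibly empty) and $\eta_1$ (nonempty). In such a representation $|\eta_0|$ is called a preperiod and $|\eta_1|$ a period of $\tilde\eta$; the minimal period is the smallest possible value of $|\eta_1|$. *)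

theory Defs
  imports Complex_Main "HOL-Library.Extended_Nat" "HOL-Library.Fun_Lexorder"
begin

text \<open>
  Sequences are indexed from 0: the value \<open>e i\<close> is the term written
  \<open>e\<^sub>i\<^sub>+\<^sub>1\<close> in 1-based notation.  Infinite sequences are functions, finite
  ones are lists, viewed as functions via \<^term>\<open>(!)\<close>.
\<close>

definition binomid_index :: "enat \<Rightarrow> (nat \<Rightarrow> nat) \<Rightarrow> bool" where
  "binomid_index m e \<longleftrightarrow>
     (\<forall>k n. 1 \<le> k \<and> k \<le> n \<and> enat n \<le> m \<longrightarrow> (\<Sum>i = n - k..<n. e i) \<ge> (\<Sum>i<k. e i))"

definition binomid_extension :: "nat list \<Rightarrow> (nat \<Rightarrow> nat) \<Rightarrow> bool" where
  "binomid_extension \<eta> e \<longleftrightarrow> binomid_index \<infinity> e \<and> (\<forall>i < length \<eta>. e i = \<eta> ! i)"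

text \<open>The relation \<^const>\<open>less_fun\<close> is the strict lexicographic order on functions.\<close>

definition is_lex_min_extension :: "nat list \<Rightarrow> (nat \<Rightarrow> nat) \<Rightarrow> bool" where
  "is_lex_min_extension \<eta> e \<longleftrightarrow>
     binomid_extension \<eta> e \<and> (\<forall>f. binomid_extension \<eta> f \<longrightarrow> f = e \<or> less_fun e f)"

text \<open>Well-defined for finite binomid indices by \<open>ex1_lex_min_extension\<close> below.\<close>

definition lex_min_extension :: "nat list \<Rightarrow> nat \<Rightarrow> nat" where
  "lex_min_extension \<eta> = (THE e. is_lex_min_extension \<eta> e)"

definition partial_sum :: "(nat \<Rightarrow> nat) \<Rightarrow> nat \<Rightarrow> nat" where
  "partial_sum e i = (\<Sum>j<i. e j)"

definition average :: "(nat \<Rightarrow> nat) \<Rightarrow> nat \<Rightarrow> real" where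
  "average e i = real (partial_sum e i) / real i"

text \<open>The infinite sequence \<open>\<eta>\<^sub>0(\<eta>\<^sub>1)\<^sup>\<infinity>\<close>, meaningful for nonempty \<open>\<eta>\<^sub>1\<close>.\<close>

definition eventually_cyclic :: "nat list \<Rightarrow> nat list \<Rightarrow> nat \<Rightarrow> nat" where
  "eventually_cyclic \<eta>\<^sub>0 \<eta>\<^sub>1 i =
     (if i < length \<eta>\<^sub>0 then \<eta>\<^sub>0 ! i else \<eta>\<^sub>1 ! ((i - length \<eta>\<^sub>0) mod length \<eta>\<^sub>1))"

definition is_period :: "(nat \<Rightarrow> nat) \<Rightarrow> nat \<Rightarrow> bool" where
  "is_period e p \<longleftrightarrow> (\<exists>\<eta>\<^sub>0 \<eta>\<^sub>1. \<eta>\<^sub>1 \<noteq> [] \<and> length \<eta>\<^sub>1 = p \<and> e = eventually_cyclic \<eta>\<^sub>0 \<eta>\<^sub>1)"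

definition is_minimal_period :: "(nat \<Rightarrow> nat) \<Rightarrow> nat \<Rightarrow> bool" where
  "is_minimal_period e p \<longleftrightarrow> is_period e p \<and> (\<forall>q. is_period e q \<longrightarrow> p \<le> q)"


lemma binomid_index_cong:
  assumes "\<And>i. i < n \<Longrightarrow> e i = f i"
  shows "binomid_index (enat n) e \<longleftrightarrow> binomid_index (enat n) f"
proof -
  have "(\<Sum>i<k. e i) = (\<Sum>i<k. f i)" if "k \<le> n" for k
    using that assms by (auto intro!: sum.cong)
  moreover have "(\<Sum>i = l - k..<l. e i) = (\<Sum>i = l - k..<l. f i)" if "l \<le> n" for k l
    using that assms by (auto intro!: sum.cong)
  ultimately show ?thesis
    unfolding binomid_index_def by simp
qed

lemma binomid_index_infinity_iff:
  "binomid_index \<infinity> e \<longleftrightarrow> (\<forall>n. binomid_index (enat n) e)"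
  unfolding binomid_index_def by auto

lemma binomid_index_mono:
  "binomid_index (enat n) e \<Longrightarrow> l \<le> n \<Longrightarrow> binomid_index (enat l) e"
  unfolding binomid_index_def by auto

lemma binomid_index_extend:
  assumes "binomid_index (enat n) e"
  shows "\<exists>x. binomid_index (enat (Suc n)) (e(n := x))"
proof
  let ?x = "\<Sum>i<n. e i" and ?f = "e(n := \<Sum>i<n. e i)"
  show "binomid_index (enat (Suc n)) ?f"
    unfolding binomid_index_def
  proof (intro allI impI)
    fix k l assume kl: "1 \<le> k \<and> k \<le> l \<and> enat l \<le> enat (Suc n)"
    show "(\<Sum>i<k. ?f i) \<le> (\<Sum>i = l - k..<l. ?f i)"
    proof (cases "l \<le> n")
      case True
      have "binomid_index (enat n) ?f"
        using assms binomid_index_cong[of n e ?f] by simp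
      with kl True show ?thesis unfolding binomid_index_def by auto
    next
      case False
      with kl have l: "l = Suc n" by simp
      show ?thesis
      proof (cases "k = l")
        case True
        then show ?thesis by (simp add: atLeast0LessThan)
      next
        case False
        with kl l have "k \<le> n" by simp
        have "(\<Sum>i<k. ?f i) = (\<Sum>i<k. e i)"
          using \<open>k \<le> n\<close> by (intro sum.cong) auto
        also have "\<dots> \<le> (\<Sum>i<n. e i)"
          using \<open>k \<le> n\<close> by (intro sum_mono2) auto
        also have "\<dots> = ?f n" by simp
        also have "\<dots> \<le> (\<Sum>i = l - k..<l. ?f i)"
          using kl l by (intro member_le_sum) auto
        finally show ?thesis .
      qed
    qed
  qed
qed

lemma ex1_lex_min_extension:
  assumes "binomid_index (enat (length \<eta>)) ((!) \<eta>)"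
  shows "\<exists>!e. is_lex_min_extension \<eta> e"
proof -
  define m where "m = length \<eta>"
  define g where "g = rec_nat ((!) \<eta>)
    (\<lambda>j h. h(m + j := LEAST x. binomid_index (enat (Suc (m + j))) (h(m + j := x))))"
  have g0: "g 0 = (!) \<eta>" by (simp add: g_def)
  have gS: "g (Suc j) = (g j)(m + j := LEAST x. binomid_index (enat (Suc (m + j))) ((g j)(m + j := x)))"
    for j by (simp add: g_def)
  have gB: "binomid_index (enat (m + j)) (g j)" for j
  proof (induction j)
    case 0
    then show ?case using assms by (simp add: g0 m_def)
  next
    case (Suc j)
    from LeastI_ex[OF binomid_index_extend[OF Suc]] show ?case
      unfolding gS add_Suc_right .
  qed
  define e where "e i = g (Suc i) i" for i
  have stable: "g (j + d) i = g j i" if "i < m + j" for i j d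
    using that by (induction d) (auto simp: gS)
  have eg: "e i = g j i" if "i < m + j" for i j
  proof (cases "Suc i \<le> j")
    case True
    then show ?thesis using stable[of i "Suc i" "j - Suc i"] by (simp add: e_def)
  next
    case False
    then show ?thesis using stable[of i j "Suc i - j"] that by (simp add: e_def)
  qed
  have eB: "binomid_index (enat n) e" for n
  proof -
    have "binomid_index (enat (m + n)) e"
      using gB[of n] binomid_index_cong[of "m + n" e "g n"] eg by blast
    then show ?thesis by (rule binomid_index_mono) simp
  qed
  have ext: "binomid_extension \<eta> e"
    unfolding binomid_extension_def binomid_index_infinity_iff
    using eB eg[of _ 0] by (auto simp: g0 m_def)
  have min: "less_fun e f" if f: "binomid_extension \<eta> f" and "f \<noteq> e" for f
  proof -
    from \<open>f \<noteq> e\<close> have ex: "\<exists>k. f k \<noteq> e k" by auto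
    define k where "k = (LEAST k. f k \<noteq> e k)"
    have k: "f k \<noteq> e k" unfolding k_def using ex by (rule LeastI_ex)
    have below: "f i = e i" if "i < k" for i
      using not_less_Least that unfolding k_def by blast
    have "m \<le> k"
      using k f ext unfolding binomid_extension_def m_def by (metis not_le)
    then obtain j where j: "k = m + j" using le_Suc_ex by blast
    have "binomid_index (enat (Suc k)) f"
      using f unfolding binomid_extension_def binomid_index_infinity_iff by blast
    moreover have "f i = ((g j)(k := f k)) i" if "i < Suc k" for i
      using that below eg[of i j] j by (cases "i = k") auto
    ultimately have "binomid_index (enat (Suc k)) ((g j)(k := f k))"
      using binomid_index_cong[of "Suc k" f "(g j)(k := f k)"] by blast
    then have "(LEAST x. binomid_index (enat (Suc k)) ((g j)(k := x))) \<le> f k"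
      by (rule Least_le)
    then have "e k \<le> f k"
      using eg[of k "Suc j"] by (simp add: j gS)
    with k have "e k < f k" by simp
    with below show ?thesis unfolding less_fun_def by metis
  qed
  have "is_lex_min_extension \<eta> e"
    unfolding is_lex_min_extension_def using ext min by blast
  moreover have "f = e" if "is_lex_min_extension \<eta> f" for f
    using that ext min less_fun_asym unfolding is_lex_min_extension_def by blast
  ultimately show ?thesis by blast
qed

end

theory Submission imports Defs begin

text \<open>
  A sequence is a binomid index iff its partial sums \<open>S\<close> are superadditive, and beyond \<open>m\<close>
  lex-minimality forces \<open>S n = S k + S (n - k)\<close> for some \<open>0 < k < n\<close>.
  Fix \<open>a \<le> m\<close> with maximal average and put \<open>D n = S a * n - a * S n\<close>, the deficit of
  \<open>S\<close> from the line of slope \<open>A_max\<close>, scaled to an integer. It is nonnegative and subadditive,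
  and the decomposition shows that every zero of \<open>D\<close> is a sum of zeros \<open>\<le> m\<close>, which are the
  indices of maximal average. If \<open>D i = 0\<close> then \<open>D (n + i) \<le> D n\<close>, so \<open>D\<close> is eventually
  \<open>i\<close>-periodic; thus the gcd \<open>g\<close> of the zeros is a period of \<open>D\<close> and of the sequence.
  Conversely, a period \<open>q\<close> of the sequence is one of \<open>D\<close>, so that some large zero \<open>n\<close> yields
  the zero \<open>n + q\<close>, whence \<open>g dvd q\<close>.
\<close>

section \<open>Eventual periods and their gcds\<close>

definition eventual_period :: "(nat \<Rightarrow> 'a) \<Rightarrow> nat \<Rightarrow> bool" where
  "eventual_period f p \<longleftrightarrow> (\<exists>N. \<forall>n\<ge>N. f (n + p) = f n)"

text \<open>Base case of \<open>eventual_period_Gcd\<close>, since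
  \<open>Gcd {} = 0\<close>.\<close>

lemma eventual_period_0: "eventual_period f 0"
  by (simp add: eventual_period_def)

lemma periodic_from_mult:
  fixes f :: "nat \<Rightarrow> 'a"
  assumes "\<And>n. n \<ge> N \<Longrightarrow> f (n + p) = f n" "n \<ge> N"
  shows "f (n + p * k) = f n"
proof (induction k)
  case (Suc k)
  have "f (n + p * Suc k) = f ((n + p * k) + p)" by (simp add: algebra_simps)
  also have "\<dots> = f n" using assms Suc by simp
  finally show ?case .
qed simp

text \<open>A shift by the gcd followed by one by \<open>q * y\<close> is a shift by
  \<open>p * x\<close>. This natural-number form of Bezout uses only forward shifts, which stay
  beyond \<open>N\<close>.\<close>

lemma eventual_period_gcd:
  assumes "eventual_period f p" "eventual_period f q"
  shows "eventual_period f (gcd p q)"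
proof (cases "p = 0")
  case False
  from assms obtain N where
    p: "\<And>n. n \<ge> N \<Longrightarrow> f (n + p) = f n" and q: "\<And>n. n \<ge> N \<Longrightarrow> f (n + q) = f n"
    unfolding eventual_period_def by (metis max.boundedE)
  obtain x y where xy: "p * x = q * y + gcd p q"
    using bezout_nat[OF False] by blast
  have "f (n + gcd p q) = f n" if "n \<ge> N" for n
  proof -
    have "f (n + gcd p q) = f (n + gcd p q + q * y)"
      using periodic_from_mult[of N f q "n + gcd p q" y] q that by simp
    also have "\<dots> = f (n + p * x)" by (simp add: xy algebra_simps)
    also have "\<dots> = f n" using periodic_from_mult[of N f p n x] p that by simp
    finally show ?thesis .
  qed
  then show ?thesis unfolding eventual_period_def by blast
qed (use assms in simp)

lemma eventual_period_Gcd: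
  assumes "finite P" "\<And>p. p \<in> P \<Longrightarrow> eventual_period f p"
  shows "eventual_period f (Gcd P)"
  using assms by (induction P) (auto intro: eventual_period_0 eventual_period_gcd)

lemma is_period_iff_eventual_period: "is_period e p \<longleftrightarrow> p > 0 \<and> eventual_period e p"
proof
  assume "is_period e p"
  then obtain xs ys where ys: "ys \<noteq> []" "length ys = p" and e: "e = eventually_cyclic xs ys"
    unfolding is_period_def by blast
  have "e (n + p) = e n" if "n \<ge> length xs" for n
  proof -
    have "n + p - length xs = (n - length xs) + p" using that by simp
    with that ys show ?thesis
      by (simp add: e eventually_cyclic_def del: Nat.add_diff_assoc2)
  qed
  with ys show "p > 0 \<and> eventual_period e p" unfolding eventual_period_def by auto
next
  assume "p > 0 \<and> eventual_period e p"
  then obtain N where p: "p > 0" and N: "\<And>n. n \<ge> N \<Longrightarrow> e (n + p) = e n"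
    unfolding eventual_period_def by blast
  have "e i = eventually_cyclic (map e [0..<N]) (map e [N..<N + p]) i" for i
  proof (cases "i < N")
    case False
    let ?r = "(i - N) mod p"
    have "i = (N + ?r) + p * ((i - N) div p)"
      using False mod_mult_div_eq[of "i - N" p] by linarith
    then have "e i = e (N + ?r)"
      using periodic_from_mult[of N e p "N + ?r" "(i - N) div p"] N by simp
    with False p show ?thesis by (simp add: eventually_cyclic_def)
  qed (simp add: eventually_cyclic_def)
  then have "e = eventually_cyclic (map e [0..<N]) (map e [N..<N + p])" by blast
  with p show "is_period e p" unfolding is_period_def
    by (intro exI[of _ "map e [0..<N]"] exI[of _ "map e [N..<N + p]"]) auto
qed

text \<open>The window sums \<open>T n\<close> of length \<open>p\<close> change by
  \<open>f (n + p) - f n\<close>, so they decrease and, being naturals, become constant.\<close>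

lemma eventual_period_if_le:
  fixes f :: "nat \<Rightarrow> nat"
  assumes "\<And>n. f (n + p) \<le> f n"
  shows "eventual_period f p"
proof -
  define T where "T n = (\<Sum>j<p. f (n + j))" for n
  have T: "T (Suc n) + f n = T n + f (n + p)" for n
    using sum.lessThan_Suc_shift[of "\<lambda>j. f (n + j)" p] by (simp add: T_def)
  have "decseq T"
    by (rule decseq_SucI) (use T assms in \<open>metis add_le_cancel_right add_le_mono le_refl\<close>)
  obtain N where N: "\<And>n. T N \<le> T n"
    using ex_has_least_nat[of "\<lambda>_. True" 0 T] by blast
  have "f (n + p) = f n" if "n \<ge> N" for n
  proof -
    have "T n = T N" "T (Suc n) = T N"
      using decseqD[OF \<open>decseq T\<close>] N that by (auto intro: antisym)
    with T[of n] show ?thesis by simp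
  qed
  then show ?thesis unfolding eventual_period_def by blast
qed

section \<open>Superadditive partial sums and lex-minimality\<close>

lemma partial_sum_0 [simp]: "partial_sum e 0 = 0"
  and partial_sum_Suc [simp]: "partial_sum e (Suc n) = partial_sum e n + e n"
  by (simp_all add: partial_sum_def)

text \<open>The sum of the \<open>k\<close> terms ending at the \<open>n\<close>-th is a difference
  of partial sums, so the index condition is superadditivity at \<open>n - k\<close> and
  \<open>k\<close>.\<close>

lemma binomid_index_infinity_iff_superadditive:
  "binomid_index \<infinity> e \<longleftrightarrow> (\<forall>i j. partial_sum e i + partial_sum e j \<le> partial_sum e (i + j))"
    (is "?L \<longleftrightarrow> ?R")
proof -
  have split: "partial_sum e n = partial_sum e (n - k) + (\<Sum>i = n - k..<n. e i)" if "k \<le> n" for k n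
    using sum.atLeastLessThan_concat[of 0 "n - k" n e] that
    by (simp add: partial_sum_def atLeast0LessThan)
  show ?thesis
  proof
    assume L: ?L
    show ?R
    proof (intro allI)
      fix i j
      show "partial_sum e i + partial_sum e j \<le> partial_sum e (i + j)"
      proof (cases "j = 0")
        case False
        with L have "partial_sum e j \<le> (\<Sum>l = i + j - j..<i + j. e l)"
          unfolding binomid_index_def partial_sum_def
          by (metis enat_ord_code(3) le_add2 less_one linorder_not_le)
        with split[of j "i + j"] show ?thesis by simp
      qed simp
    qed
  next
    assume R: ?R
    show ?L unfolding binomid_index_def
    proof (intro allI impI)
      fix k n assume "1 \<le> k \<and> k \<le> n \<and> enat n \<le> \<infinity>"
      then have "k \<le> n" by simp
      with R[rule_format, of "n - k" k] split[of k n] show "(\<Sum>i<k. e i) \<le> (\<Sum>i = n - k..<n. e i)"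
        by (simp add: partial_sum_def)
    qed
  qed
qed

text \<open>If no decomposition existed, moving one unit from the \<open>n\<close>-th term to the next one would
  lower only \<open>S n\<close>, keeping superadditivity and giving a smaller extension.\<close>

lemma lex_min_extension_decompose:
  assumes min: "is_lex_min_extension \<eta> e" and n: "n > length \<eta>" "\<eta> \<noteq> []"
  obtains k where "0 < k" "k < n" "partial_sum e n = partial_sum e k + partial_sum e (n - k)"
proof (rule ccontr)
  assume "\<not> thesis"
  with that have neq: "partial_sum e n \<noteq> partial_sum e k + partial_sum e (n - k)"
    if "0 < k" "k < n" for k
    using \<open>0 < k\<close> \<open>k < n\<close> by blast
  have ext: "binomid_extension \<eta> e" using min by (simp add: is_lex_min_extension_def)
  then have super: "partial_sum e i + partial_sum e j \<le> partial_sum e (i + j)" for i j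
    by (simp add: binomid_extension_def binomid_index_infinity_iff_superadditive)
  have less: "partial_sum e i + partial_sum e j < partial_sum e n" if "i + j = n" "0 < i" "0 < j" for i j
    using super[of i j] neq[of i] that by force
  obtain l where l: "n = Suc l" using n by (cases n) auto
  have "length \<eta> > 0" using n by simp
  \<comment> \<open>Strictness at \<open>l\<close> and \<open>1\<close> gives
    \<open>e l > partial_sum e 1\<close>, so there is a unit to move.\<close>
  have pos: "e l > 0" using less[of l 1] n l \<open>length \<eta> > 0\<close> by simp
  define f where "f = e(l := e l - 1, n := e n + 1)"
  have f_l: "partial_sum f i = partial_sum e i" if "i \<le> l" for i
    using that unfolding partial_sum_def by (intro sum.cong) (auto simp: f_def l)
  have f_n: "Suc (partial_sum f n) = partial_sum e n"
    using pos f_l[of l] by (simp add: l f_def)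
  have f_ge: "partial_sum f (Suc n + i) = partial_sum e (Suc n + i)" for i
    using f_n by (induction i) (auto simp: f_def l)
  have f_sum: "partial_sum f i = (if i = n then partial_sum e n - 1 else partial_sum e i)" for i
  proof (cases "i > n")
    case True
    then have "i = Suc n + (i - Suc n)" by simp
    with True f_ge[of "i - Suc n"] show ?thesis by simp
  next
    case False
    then show ?thesis using f_l[of i] f_n l by (cases "i = n") auto
  qed
  have "partial_sum f i + partial_sum f j \<le> partial_sum f (i + j)" for i j
  proof (cases "i = 0 \<or> j = 0")
    case False
    have "partial_sum f i + partial_sum f j \<le> partial_sum e i + partial_sum e j"
      by (intro add_mono) (simp_all add: f_sum)
    \<comment> \<open>The strictness in \<open>less\<close> pays for the unit lost at
      \<open>i + j = n\<close>.\<close>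
    also have "\<dots> \<le> partial_sum f (i + j)"
      using less[of i j] super[of i j] False by (auto simp: f_sum)
    finally show ?thesis .
  qed auto
  \<comment> \<open>Since \<open>n > length \<eta>\<close>, also
    \<open>l \<ge> length \<eta>\<close>: both changed terms lie beyond
    \<open>\<eta>\<close>.\<close>
  then have "binomid_extension \<eta> f"
    using ext n l
    by (auto simp: binomid_extension_def binomid_index_infinity_iff_superadditive f_def)
  moreover have "f l < e l" "\<forall>i<l. f i = e i" using pos by (auto simp: f_def l)
  then have "less_fun f e" unfolding less_fun_def by auto
  ultimately show False
    using min less_fun_asym less_fun_irrefl unfolding is_lex_min_extension_def by metis
qed

section \<open>The deficit from the line of maximal slope\<close>

locale generated_superadditive =
  fixes S :: "nat \<Rightarrow> nat" and m a :: nat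
  assumes S_0: "S 0 = 0"
    and super: "S i + S j \<le> S (i + j)"
    and decompose: "n > m \<Longrightarrow> \<exists>k. 0 < k \<and> k < n \<and> S n = S k + S (n - k)"
    and a: "0 < a" "a \<le> m"
    and a_max: "i \<le> m \<Longrightarrow> a * S i \<le> S a * i"
begin

text \<open>\<open>a_max\<close> compares averages with denominators cleared; it passes to
  \<open>n > m\<close> by adding the bounds for the two parts of a decomposition.\<close>

lemma below_line: "a * S n \<le> S a * n"
proof (induction n rule: less_induct)
  case (less n)
  show ?case
  proof (cases "n \<le> m")
    case False
    then obtain k where k: "0 < k" "k < n" "S n = S k + S (n - k)" using decompose[of n] by auto
    have "a * S n = a * S k + a * S (n - k)" by (simp add: k algebra_simps)
    also have "\<dots> \<le> S a * k + S a * (n - k)"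
      using less[of k] less[of "n - k"] k by (intro add_mono) auto
    also have "\<dots> = S a * n" using k by (simp flip: distrib_left)
    finally show ?thesis .
  qed (rule a_max)
qed

text \<open>By \<open>below_line\<close> the subtraction is never truncated.\<close>

definition D :: "nat \<Rightarrow> nat" where
  "D n = S a * n - a * S n"

lemma D_eq: "D n + a * S n = S a * n"
  using below_line[of n] by (simp add: D_def)

lemma D_subadditive: "D (i + j) \<le> D i + D j"
proof -
  have "a * S i + a * S j \<le> a * S (i + j)"
    using mult_le_mono2[OF super] by (simp flip: distrib_left)
  with D_eq[of i] D_eq[of j] D_eq[of "i + j"] show ?thesis by (simp add: distrib_left)
qed

lemma D_a: "D a = 0"
  by (simp add: D_def)

text \<open>Supplies zeros of \<open>D\<close> beyond any bound, where a given eventual period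
  already holds.\<close>

lemma D_mult_a: "D (a * k) = 0"
proof (induction k)
  case (Suc k)
  then show ?case using D_subadditive[of a "a * k"] D_a by simp
qed (simp add: D_def)

definition zero_gcd :: nat where
  "zero_gcd = Gcd {i. 1 \<le> i \<and> i \<le> m \<and> D i = 0}"

text \<open>Above \<open>m\<close>, \<open>D\<close> is additive along the decomposition of
  \<open>n\<close>; as its values are naturals, a zero splits into two smaller zeros.\<close>

lemma zero_gcd_dvd: "D n = 0 \<Longrightarrow> zero_gcd dvd n"
proof (induction n rule: less_induct)
  case (less n)
  show ?case
  proof (cases "n \<le> m")
    case True
    with less.prems show ?thesis by (cases "n = 0") (auto simp: zero_gcd_def)
  next
    case False
    then obtain k where k: "0 < k" "k < n" "S n = S k + S (n - k)" using decompose[of n] by auto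
    have "S a * n = S a * k + S a * (n - k)" using k by (simp flip: distrib_left)
    moreover have "a * S n = a * S k + a * S (n - k)" by (simp add: k algebra_simps)
    ultimately have "D n = D k + D (n - k)"
      using D_eq[of n] D_eq[of k] D_eq[of "n - k"] by linarith
    with less k have "zero_gcd dvd k" "zero_gcd dvd n - k" by auto
    then have "zero_gcd dvd k + (n - k)" by (rule dvd_add)
    with k show ?thesis by simp
  qed
qed

lemma zero_gcd_pos: "zero_gcd > 0"
  using zero_gcd_dvd[OF D_a] a by (auto intro: Nat.gr0I)

lemma eventual_period_D: "eventual_period D zero_gcd"
  unfolding zero_gcd_def
proof (rule eventual_period_Gcd)
  fix p assume "p \<in> {i. 1 \<le> i \<and> i \<le> m \<and> D i = 0}"
  then have "D (n + p) \<le> D n" for n using D_subadditive[of n p] by simp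
  then show "eventual_period D p" by (rule eventual_period_if_le)
qed auto

lemma eventual_period_increments:
  assumes e: "\<And>n. S (Suc n) = S n + e n"
  shows "eventual_period e zero_gcd"
proof -
  \<comment> \<open>As \<open>a > 0\<close>, this recovers \<open>e n\<close> from
    \<open>D n\<close> and \<open>D (Suc n)\<close>.\<close>
  have step: "D (Suc n) + a * e n = D n + S a" for n
    using D_eq[of n] D_eq[of "Suc n"] by (simp add: e distrib_left)
  obtain N where N: "\<And>n. n \<ge> N \<Longrightarrow> D (n + zero_gcd) = D n"
    using eventual_period_D unfolding eventual_period_def by blast
  have "e (n + zero_gcd) = e n" if "n \<ge> N" for n
  proof -
    have "D (Suc n) + a * e (n + zero_gcd) = D (Suc n) + a * e n"
      using step[of n] step[of "n + zero_gcd"] N[of n] N[of "Suc n"] that by simp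
    then show ?thesis using a by simp
  qed
  then show ?thesis unfolding eventual_period_def by blast
qed

lemma zero_gcd_dvd_eventual_period:
  assumes e: "\<And>n. S (Suc n) = S n + e n" and q: "eventual_period e q"
  shows "zero_gcd dvd q"
proof -
  obtain N where N: "\<And>n. n \<ge> N \<Longrightarrow> e (n + q) = e n"
    using q unfolding eventual_period_def by blast
  \<comment> \<open>Periodic increments alone allow \<open>D\<close> to drift by a constant over
    \<open>q\<close> steps, possibly negative, hence the integers.\<close>
  define c where "c = int (D (N + q)) - int (D N)"
  have D_step: "int (D (Suc n)) + int a * int (e n) = int (D n) + int (S a)" for n
    using D_eq[of n] D_eq[of "Suc n"]
    by (simp add: e distrib_left flip: of_nat_add of_nat_mult)
  have drift: "int (D (n + q)) = int (D n) + c" if "n \<ge> N" for n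
    using that
  proof (induction n rule: dec_induct)
    case (step n)
    then show ?case using D_step[of n] D_step[of "n + q"] N[of n] by simp
  qed (simp add: c_def)
  have drift_mult: "int (D (n + q * k)) = int (D n) + int k * c" if "n \<ge> N" for n k
  proof (induction k)
    case (Suc k)
    then show ?case using drift[of "n + q * k"] that by (simp add: algebra_simps)
  qed simp
  have N_le: "N \<le> a * N" using a by simp
  \<comment> \<open>Taking \<open>a\<close> shifts by \<open>q\<close> leads from the zero
    \<open>a * N\<close> to the zero \<open>a * (N + q)\<close>, so the total drift
    vanishes.\<close>
  have "int a * c = 0"
    using drift_mult[OF N_le, of a] D_mult_a[of N] D_mult_a[of "N + q"]
    by (simp add: algebra_simps)
  then have "c = 0" using a by simp
  then have "D (a * N + q) = 0" using drift[OF N_le] D_mult_a[of N] by simp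
  then have "zero_gcd dvd a * N + q" by (rule zero_gcd_dvd)
  moreover have "zero_gcd dvd a * N" using zero_gcd_dvd[OF D_mult_a] .
  ultimately show ?thesis using dvd_add_right_iff by blast
qed

end

section \<open>From averages to the minimal period\<close>

theorem theorem3p4:
  fixes m :: nat and \<eta> :: "nat list" and A :: "nat \<Rightarrow> real" and A_max :: real
  assumes "m \<ge> 1"
    and "length \<eta> = m"
    and "binomid_index (enat m) ((!) \<eta>)"
    and "\<And>i. A i = average (lex_min_extension \<eta>) i"
    and "A_max = Max {A i | i. 1 \<le> i \<and> i \<le> m}"
  shows "is_minimal_period (lex_min_extension \<eta>) (Gcd {i. 1 \<le> i \<and> i \<le> m \<and> A i = A_max})"
proof -
  define e where "e = lex_min_extension \<eta>"
  define S where "S = partial_sum e"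
  have A: "A i = real (S i) / real i" for i
    using assms(4) by (simp add: average_def S_def e_def)
  have min: "is_lex_min_extension \<eta> e"
    unfolding e_def lex_min_extension_def
    by (rule theI'[OF ex1_lex_min_extension]) (use assms(2,3) in simp)
  have "{A i | i. 1 \<le> i \<and> i \<le> m} = A ` {1..m}" by auto
  with assms(5) have A_max: "A_max = Max (A ` {1..m})" by simp
  have "Max (A ` {1..m}) \<in> A ` {1..m}" using assms(1) by (intro Max_in) auto
  then obtain a where "a \<in> {1..m}" and A_a: "A a = A_max" unfolding A_max by (metis imageE)
  then have a: "0 < a" "a \<le> m" by simp_all
  have A_le: "A i \<le> A a" if "0 < i" "i \<le> m" for i
  proof -
    have "A i \<in> A ` {1..m}" using that by simp
    then show ?thesis by (simp only: A_a A_max Max_ge finite_imageI finite_atLeastAtMost)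
  qed
  interpret generated_superadditive S m a
  proof
    show "S 0 = 0" by (simp add: S_def)
    show "S i + S j \<le> S (i + j)" for i j
      using min unfolding S_def is_lex_min_extension_def binomid_extension_def
        binomid_index_infinity_iff_superadditive by blast
    show "\<exists>k. 0 < k \<and> k < n \<and> S n = S k + S (n - k)" if "n > m" for n
    proof -
      have "n > length \<eta>" "\<eta> \<noteq> []" using that assms(1,2) by auto
      then show ?thesis using lex_min_extension_decompose[OF min] unfolding S_def by blast
    qed
    show "a * S i \<le> S a * i" if "i \<le> m" for i
    \<comment> \<open>Averages say nothing at \<open>i = 0\<close>, where division by zero gives a
      default value; there \<open>S 0 = 0\<close> suffices.\<close>
    proof (cases "i = 0")
      case False
      then have "real (a * S i) \<le> real (S a * i)"
        using A_le[of i] that a by (simp add: A field_simps)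
      then show ?thesis by (simp only: of_nat_le_iff)
    qed (simp add: S_def)
  qed (use a in auto)
  \<comment> \<open>Multiplying by \<open>a\<close> and \<open>i\<close> turns equality of averages
    into \<open>a * S i = S a * i\<close>.\<close>
  have "A i = A_max \<longleftrightarrow> D i = 0" if "0 < i" for i
  proof -
    have "A i = A_max \<longleftrightarrow> real (a * S i) = real (S a * i)"
      unfolding A_a[symmetric] using that a by (simp add: A field_simps)
    also have "\<dots> \<longleftrightarrow> D i = 0" unfolding of_nat_eq_iff using D_eq[of i] by linarith
    finally show ?thesis .
  qed
  then have "{i. 1 \<le> i \<and> i \<le> m \<and> A i = A_max} = {i. 1 \<le> i \<and> i \<le> m \<and> D i = 0}"
    by (intro Collect_cong) (metis less_eq_Suc_le One_nat_def)
  then have "Gcd {i. 1 \<le> i \<and> i \<le> m \<and> A i = A_max} = zero_gcd"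
    by (simp only: zero_gcd_def)
  moreover have "S (Suc n) = S n + e n" for n by (simp add: S_def)
  \<comment> \<open>Every period is a positive multiple of \<open>zero_gcd\<close>, hence at least
    as large.\<close>
  then have "is_minimal_period e zero_gcd"
    unfolding is_minimal_period_def is_period_iff_eventual_period
    using zero_gcd_pos eventual_period_increments zero_gcd_dvd_eventual_period
    by (blast intro: dvd_imp_le)
  ultimately show ?thesis by (simp add: e_def)
qed

end
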